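(* Let $f^{\{1\}},\dots,f^{\{N\}}:\mathbb{R}^d\to\mathbb{R}^d$ be such that, for a common scalar product $\langle\cdot,\cdot\rangle$ on $\mathbb{R}^d$ with associated norm $\|\cdot\|$, there are $\nu^{\{m\}}<0$ with $$\big\langle f^{\{m\}}(y)-f^{\{m\}}(z),\,y-z\big\rangle\le \nu^{\{m\}}\|y-z\|^2\qquad\text{for all }y,z\in\mathbb{R}^d,\ m=1,\dots,N.$$ Consider an algebraically stable GARK method applied to $y'=\sum_{m=1}^N f^{\{m\}}(y)$. Then the method is unconditionally nonlinearly stable: for any step size $h>0$ and any two numerical solutions $y_n\mapsto y_{n+1}$ and $\widetilde y_n\mapsto\widetilde y_{n+1}$ computed by the method with step size $h$, $$\|\widetilde y_{n+1}-y_{n+1}\|\le\|\widetilde y_n-y_n\|.$$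
   Context: GARK method: with real coefficients $\mathbf{A}^{\{q,m\}}=(a_{i,j}^{\{q,m\}})\in\mathbb{R}^{s^{\{q\}}\times s^{\{m\}}}$, $\mathbf{b}^{\{q\}}=(b_i^{\{q\}})\in\mathbb{R}^{s^{\{q\}}}$, one step of size $h$ applied to $y'=\sum_{m=1}^N f^{\{m\}}(y)$ is $$Y_i^{\{q\}} = y_n + h\sum_{m=1}^N\sum_{j=1}^{s^{\{m\}}} a_{i,j}^{\{q,m\}} f^{\{m\}}\big(Y_j^{\{m\}}\big),\quad i=1,\dots,s^{\{q\}},\ q=1,\dots,N,$$ $$y_{n+1}=y_n+h\sum_{q=1}^N\sum_{i=1}^{s^{\{q\}}} b_i^{\{q\}} f^{\{q\}}\big(Y_i^{\{q\}}\big).$$ A numerical solution means values $Y_i^{\{q\}}, y_{n+1}$ satisfying these equations. Define $\mathbf{B}^{\{m\}}=\mathrm{diag}(\mathbf{b}^{\{m\}})$ and, for $m,\ell=1,\dots,N$, $$\mathbf{P}^{\{m,\ell\}}=(\mathbf{A}^{\{\ell,m\}})^T\mathbf{B}^{\{\ell\}}+\mathbf{B}^{\{m\}}\mathbf{A}^{\{m,\ell\}}-\mathbf{b}^{\{m\}}(\mathbf{b}^{\{\ell\}})^T\in\mathbb{R}^{s^{\{m\}}\times s^{\{\ell\}}},$$ so $\mathbf{P}^{\{\ell,m\}}=(\mathbf{P}^{\{m,\ell\}})^T$. The GARK method is algebraically stable if $b_i^{\{m\}}\ge 0$ for all $i=1,\dots,s^{\{m\}}$ and $m=1,\dots,N$,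 and the symmetric block matrix $\mathbf{P}=[\mathbf{P}^{\{\ell,m\}}]_{1\le\ell,m\le N}\in\mathbb{R}^{s\times s}$, $s=\sum_q s^{\{q\}}$, is non-negative definite. *)

theory Defs
  imports "HOL-Analysis.Analysis" "Jordan_Normal_Form.Matrix"
begin

text \<open>
  The blocks of a GARK method have sizes that depend on their position, so stage matrices and
  weights are matrices and vectors of the AFP entry Jordan Normal Form, constrained by carrier
  sets; states live in \<open>real ^ 'd\<close>. Partitions and stages are numbered from \<open>0\<close>.
\<close>

definition is_scalar_product :: "('v::real_vector \<Rightarrow> 'v \<Rightarrow> real) \<Rightarrow> bool" where
  "is_scalar_product ip \<longleftrightarrow>
     bilinear ip \<and> (\<forall>x y. ip x y = ip y x) \<and> (\<forall>x. x \<noteq> 0 \<longrightarrow> 0 < ip x x)"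

definition ip_norm :: "('v \<Rightarrow> 'v \<Rightarrow> real) \<Rightarrow> 'v \<Rightarrow> real" where
  "ip_norm ip x = sqrt (ip x x)"

definition gark_coefficients ::
    "nat \<Rightarrow> (nat \<Rightarrow> nat) \<Rightarrow> (nat \<Rightarrow> nat \<Rightarrow> real mat) \<Rightarrow> (nat \<Rightarrow> real vec) \<Rightarrow> bool" where
  "gark_coefficients N s A b \<longleftrightarrow>
     (\<forall>q<N. \<forall>m<N. A q m \<in> carrier_mat (s q) (s m)) \<and> (\<forall>q<N. b q \<in> carrier_vec (s q))"

definition gark_solution ::
    "nat \<Rightarrow> (nat \<Rightarrow> nat) \<Rightarrow> (nat \<Rightarrow> nat \<Rightarrow> real mat) \<Rightarrow> (nat \<Rightarrow> real vec) \<Rightarrow>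
     (nat \<Rightarrow> 'v::real_vector \<Rightarrow> 'v) \<Rightarrow> real \<Rightarrow> 'v \<Rightarrow> (nat \<Rightarrow> nat \<Rightarrow> 'v) \<Rightarrow> 'v \<Rightarrow> bool" where
  "gark_solution N s A b f h y0 Y y1 \<longleftrightarrow>
     (\<forall>q<N. \<forall>i<s q.
        Y q i = y0 + h *\<^sub>R (\<Sum>m<N. \<Sum>j<s m. (A q m $$ (i, j)) *\<^sub>R f m (Y m j))) \<and>
     y1 = y0 + h *\<^sub>R (\<Sum>q<N. \<Sum>i<s q. vec_index (b q) i *\<^sub>R f q (Y q i))"

definition diag_of_vec :: "real vec \<Rightarrow> real mat" where
  "diag_of_vec v = mat_diag (dim_vec v) (vec_index v)"

definition outer_product :: "real vec \<Rightarrow> real vec \<Rightarrow> real mat" where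
  "outer_product v w = mat_of_cols (dim_vec v) [v] * mat_of_rows (dim_vec w) [w]"

definition gark_P ::
    "(nat \<Rightarrow> nat \<Rightarrow> real mat) \<Rightarrow> (nat \<Rightarrow> real vec) \<Rightarrow> nat \<Rightarrow> nat \<Rightarrow> real mat" where
  "gark_P A b m l =
     transpose_mat (A l m) * diag_of_vec (b l) + diag_of_vec (b m) * A m l
       - outer_product (b m) (b l)"

text \<open>
  \<open>block_index N s ! I = (q, i)\<close> says that the global row (or column) \<open>I\<close> is the local row (or
  column) \<open>i\<close> of block \<open>q\<close>; the list has length \<open>\<Sum>q<N. s q\<close>.
\<close>

definition block_index :: "nat \<Rightarrow> (nat \<Rightarrow> nat) \<Rightarrow> (nat \<times> nat) list" where
  "block_index N s = concat (map (\<lambda>q. map (Pair q) [0..<s q]) [0..<N])"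

definition block_matrix :: "nat \<Rightarrow> (nat \<Rightarrow> nat) \<Rightarrow> (nat \<Rightarrow> nat \<Rightarrow> real mat) \<Rightarrow> real mat" where
  "block_matrix N s M =
     mat (\<Sum>q<N. s q) (\<Sum>q<N. s q)
       (\<lambda>(I, J). case block_index N s ! I of (l, i) \<Rightarrow>
                 case block_index N s ! J of (m, j) \<Rightarrow> M l m $$ (i, j))"

definition nonneg_definite :: "real mat \<Rightarrow> bool" where
  "nonneg_definite M \<longleftrightarrow>
     square_mat M \<and> transpose_mat M = M \<and>
     (\<forall>x \<in> carrier_vec (dim_row M). 0 \<le> scalar_prod x (M *\<^sub>v x))"

definition algebraically_stable ::
    "nat \<Rightarrow> (nat \<Rightarrow> nat) \<Rightarrow> (nat \<Rightarrow> nat \<Rightarrow> real mat) \<Rightarrow> (nat \<Rightarrow> real vec) \<Rightarrow> bool" where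
  "algebraically_stable N s A b \<longleftrightarrow>
     (\<forall>m<N. \<forall>i<s m. 0 \<le> vec_index (b m) i) \<and> nonneg_definite (block_matrix N s (gark_P A b))"

end

theory Submission
  imports Defs
begin

text \<open>
  The proof is the energy argument of Burrage and Butcher, carried out on the partitioned method
  as if it were a single Runge--Kutta method whose stages are numbered by the pairs
  \<open>(q, i)\<close>. Let \<open>D\<close> and \<open>E\<close> be the differences of the two solutions before and after
  the step, \<open>Z p\<close> the difference of the values at stage \<open>p\<close>, and \<open>F p\<close> the
  difference of the partition's right-hand side there. Expanding \<open>\<langle>E, E\<rangle>\<close> and eliminating
  \<open>D\<close> from the mixed terms by the stage equations gives (\<open>energy_identity\<close>)
  \[ \langle E, E\rangle = \langle D, D\rangle + 2h \sum_p b_p \langle F_p, Z_p\rangle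
       - h^2 \sum_{p,r} P_{p,r} \langle F_p, F_r\rangle , \]
  where \<open>P\<close> is the matrix of algebraic stability.
  The middle sum is at most zero, because the weights are non-negative and every right-hand side
  is dissipative. The last sum is at least zero, because a non-negative definite matrix stays
  non-negative when the numbers in its quadratic form are replaced by vectors and the products by
  inner products (\<open>vector_quadratic_form_nonneg\<close>). Neither bound restricts \<open>h\<close>.
\<close>

section \<open>Quadratic forms with vector arguments\<close>

lemma scalar_product_bilinear: "is_scalar_product ip \<Longrightarrow> bilinear ip"
  and scalar_product_commute: "is_scalar_product ip \<Longrightarrow> ip x y = ip y x"
  and scalar_product_pos: "is_scalar_product ip \<Longrightarrow> x \<noteq> 0 \<Longrightarrow> 0 < ip x x"
  by (auto simp: is_scalar_product_def)

lemma bilinear_sum_left: "bilinear B \<Longrightarrow> B (\<Sum>i\<in>S. g i) y = (\<Sum>i\<in>S. B (g i) y)"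
  unfolding bilinear_def using linear_sum[of "\<lambda>x. B x y" g S] by blast

lemma bilinear_sum_right: "bilinear B \<Longrightarrow> B x (\<Sum>i\<in>S. g i) = (\<Sum>i\<in>S. B x (g i))"
  by (simp add: bilinear_def linear_sum)

text \<open>
  Projecting every \<open>F p\<close> along one fixed non-zero vector \<open>F k\<close> splits the sum, by
  orthogonality, into \<open>\<langle>F k, F k\<rangle>\<close> times a value of the scalar form and the same sum for the
  projections. Since \<open>F k\<close> itself is projected to zero, and zero vectors stay zero, the number
  of non-zero vectors drops, which is the induction measure. This avoids choosing an orthonormal
  basis.
\<close>

lemma vector_quadratic_form_nonneg:
  fixes ip :: "'v::real_vector \<Rightarrow> 'v \<Rightarrow> real" and P :: "'k \<Rightarrow> 'k \<Rightarrow> real"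
  assumes ip: "is_scalar_product ip" and fin: "finite K"
    and psd: "\<And>x. 0 \<le> (\<Sum>p\<in>K. \<Sum>r\<in>K. P p r * (x p * x r))"
  shows "0 \<le> (\<Sum>p\<in>K. \<Sum>r\<in>K. P p r * ip (F p) (F r))"
proof (induction "card {p \<in> K. F p \<noteq> 0}" arbitrary: F rule: less_induct)
  case less
  note bil = scalar_product_bilinear[OF ip]
  show ?case
  proof (cases "\<exists>k\<in>K. F k \<noteq> 0")
    case False
    then show ?thesis by (simp add: bilinear_lzero[OF bil])
  next
    case True
    then obtain k where k: "k \<in> K" "F k \<noteq> 0" by blast
    define e where "e = F k"
    have e: "0 < ip e e" using scalar_product_pos[OF ip] k by (simp add: e_def)
    define c where "c p = ip e (F p) / ip e e" for p
    define G where "G p = F p - c p *\<^sub>R e" for p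
    have orth: "ip e (G p) = 0" for p
      using e by (simp add: G_def c_def bilinear_rsub[OF bil] bilinear_rmul[OF bil])
    have orth': "ip (G p) e = 0" for p
      using orth scalar_product_commute[OF ip] by metis
    have F: "F p = c p *\<^sub>R e + G p" for p by (simp add: G_def)
    have split: "ip (F p) (F r) = ip e e * (c p * c r) + ip (G p) (G r)" for p r
      unfolding F[of p] F[of r]
      by (simp add: bilinear_ladd[OF bil] bilinear_radd[OF bil] bilinear_lmul[OF bil]
          bilinear_rmul[OF bil] orth orth')
    have "G k = 0" using e by (simp add: G_def c_def e_def)
    moreover have "G p = 0" if "F p = 0" for p
      using that by (simp add: G_def c_def bilinear_rzero[OF bil])
    ultimately have "{p \<in> K. G p \<noteq> 0} \<subset> {p \<in> K. F p \<noteq> 0}" using k by blast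
    then have "card {p \<in> K. G p \<noteq> 0} < card {p \<in> K. F p \<noteq> 0}"
      using fin by (intro psubset_card_mono) auto
    then have G: "0 \<le> (\<Sum>p\<in>K. \<Sum>r\<in>K. P p r * ip (G p) (G r))" by (rule less)
    have "(\<Sum>p\<in>K. \<Sum>r\<in>K. P p r * ip (F p) (F r))
        = ip e e * (\<Sum>p\<in>K. \<Sum>r\<in>K. P p r * (c p * c r))
          + (\<Sum>p\<in>K. \<Sum>r\<in>K. P p r * ip (G p) (G r))"
      by (simp add: split sum_distrib_left sum.distrib algebra_simps)
    then show ?thesis using e psd[of c] G by simp
  qed
qed

section \<open>The energy identity\<close>

text \<open>
  In the mixed terms \<open>\<langle>D, F p\<rangle>\<close> of the expanded square, \<open>D\<close> is replaced by
  \<open>Z p - h \<Sum>r. a p r F r\<close>. The resulting double sum over \<open>b p * a p r\<close> enters with the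
  factor two; symmetry of the inner product turns this into the symmetric coefficients of the
  stability matrix.
\<close>

lemma energy_identity:
  fixes ip :: "'v::real_vector \<Rightarrow> 'v \<Rightarrow> real" and a :: "'k \<Rightarrow> 'k \<Rightarrow> real"
  assumes ip: "is_scalar_product ip"
    and Z: "\<And>p. p \<in> K \<Longrightarrow> Z p = D + h *\<^sub>R (\<Sum>r\<in>K. a p r *\<^sub>R F r)"
    and E: "E = D + h *\<^sub>R (\<Sum>p\<in>K. \<beta> p *\<^sub>R F p)"
  shows "ip E E = ip D D + 2 * h * (\<Sum>p\<in>K. \<beta> p * ip (F p) (Z p))
    - h\<^sup>2 * (\<Sum>p\<in>K. \<Sum>r\<in>K. (a r p * \<beta> r + \<beta> p * a p r - \<beta> p * \<beta> r) * ip (F p) (F r))"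
proof -
  note bil = scalar_product_bilinear[OF ip]
  note com = scalar_product_commute[OF ip]
  note lin = bilinear_ladd[OF bil] bilinear_radd[OF bil] bilinear_lmul[OF bil]
    bilinear_rmul[OF bil] bilinear_sum_left[OF bil] bilinear_sum_right[OF bil]
  define U where "U = (\<Sum>p\<in>K. \<beta> p * ip (F p) D)"
  define Q where "Q = (\<Sum>p\<in>K. \<Sum>r\<in>K. \<beta> p * \<beta> r * ip (F p) (F r))"
  define R where "R = (\<Sum>p\<in>K. \<Sum>r\<in>K. \<beta> p * a p r * ip (F p) (F r))"
  have U: "ip (\<Sum>p\<in>K. \<beta> p *\<^sub>R F p) D = U" by (simp add: U_def lin)
  have Q: "ip (\<Sum>p\<in>K. \<beta> p *\<^sub>R F p) (\<Sum>p\<in>K. \<beta> p *\<^sub>R F p) = Q"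
    by (simp add: Q_def lin com sum_distrib_left ac_simps)
  have "ip E E = ip D D + 2 * h * U + h\<^sup>2 * Q"
    using U Q com[of D "\<Sum>p\<in>K. \<beta> p *\<^sub>R F p"] unfolding E
    by (simp add: bilinear_ladd[OF bil] bilinear_radd[OF bil] bilinear_lmul[OF bil]
        bilinear_rmul[OF bil] power2_eq_square algebra_simps)
  moreover have "(\<Sum>p\<in>K. \<beta> p * ip (F p) (Z p)) = U + h * R"
  proof -
    have "(\<Sum>p\<in>K. \<beta> p * ip (F p) (Z p))
        = (\<Sum>p\<in>K. \<beta> p * ip (F p) D + h * (\<Sum>r\<in>K. \<beta> p * a p r * ip (F p) (F r)))"
      by (rule sum.cong) (simp_all add: Z lin sum_distrib_left algebra_simps)
    then show ?thesis by (simp add: U_def R_def sum.distrib sum_distrib_left)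
  qed
  moreover have "(\<Sum>p\<in>K. \<Sum>r\<in>K. (a r p * \<beta> r + \<beta> p * a p r - \<beta> p * \<beta> r) * ip (F p) (F r))
      = 2 * R - Q"
  proof -
    have "(\<Sum>p\<in>K. \<Sum>r\<in>K. a r p * \<beta> r * ip (F p) (F r))
        = (\<Sum>r\<in>K. \<Sum>p\<in>K. a r p * \<beta> r * ip (F p) (F r))"
      by (rule sum.swap)
    also have "\<dots> = R" unfolding R_def by (intro sum.cong) (simp_all add: com mult.commute)
    finally have "(\<Sum>p\<in>K. \<Sum>r\<in>K. a r p * \<beta> r * ip (F p) (F r)) = R" .
    then show ?thesis
      by (simp add: Q_def R_def distrib_right left_diff_distrib sum.distrib sum_subtractf)
  qed
  ultimately show ?thesis by (simp only:) (simp add: power2_eq_square algebra_simps)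
qed

section \<open>Block matrices as matrices indexed by stages\<close>

abbreviation stages :: "nat \<Rightarrow> (nat \<Rightarrow> nat) \<Rightarrow> (nat \<times> nat) set" where
  "stages N s \<equiv> SIGMA q:{..<N}. {..<s q}"

lemma set_block_index: "set (block_index N s) = stages N s"
  by (auto simp: block_index_def)

lemma length_block_index: "length (block_index N s) = (\<Sum>q<N. s q)"
  by (induction N) (simp_all add: block_index_def)

lemma distinct_block_index: "distinct (block_index N s)"
proof (induction N)
  case (Suc N)
  have "block_index (Suc N) s = block_index N s @ map (Pair N) [0..<s N]"
    by (simp add: block_index_def)
  with Suc show ?case by (auto simp: set_block_index distinct_map inj_on_def)
qed (simp add: block_index_def)

lemma sum_block_index:
  "(\<Sum>I<(\<Sum>q<N. s q). g (block_index N s ! I)) = (\<Sum>p\<in>stages N s. g p)"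
  by (rule sum.reindex_bij_betw, rule bij_betw_nth)
     (simp_all add: distinct_block_index length_block_index set_block_index)

text \<open>
  The test vector is \<open>x\<close>, read in the order in which the blocks list the stages.
\<close>

lemma nonneg_definite_block_matrixD:
  assumes "nonneg_definite (block_matrix N s M)"
  shows "0 \<le> (\<Sum>p\<in>stages N s. \<Sum>r\<in>stages N s.
    M (fst p) (fst r) $$ (snd p, snd r) * (x p * x r))"
proof -
  define n where "n = (\<Sum>q<N. s q)"
  define v where "v = vec n (\<lambda>I. x (block_index N s ! I))"
  let ?B = "block_matrix N s M"
  let ?g = "\<lambda>p r. M (fst p) (fst r) $$ (snd p, snd r) * (x p * x r)"
  have dim: "dim_row ?B = n" "dim_col ?B = n" by (simp_all add: block_matrix_def n_def)
  have "scalar_prod v (?B *\<^sub>v v) = (\<Sum>I<n. vec_index v I * (\<Sum>J<n. ?B $$ (I, J) * vec_index v J))"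
    by (simp add: scalar_prod_def dim lessThan_atLeast0 v_def)
  also have "\<dots> = (\<Sum>I<n. \<Sum>J<n. ?g (block_index N s ! I) (block_index N s ! J))"
    unfolding sum_distrib_left
    by (intro sum.cong)
       (simp_all add: v_def block_matrix_def n_def[symmetric] case_prod_unfold)
  also have "\<dots> = (\<Sum>p\<in>stages N s. \<Sum>r\<in>stages N s. ?g p r)"
    unfolding n_def sum_block_index[where g = "?g p" for p]
    by (rule sum_block_index[where g = "\<lambda>p. \<Sum>r\<in>stages N s. ?g p r"])
  finally have "scalar_prod v (?B *\<^sub>v v) = (\<Sum>p\<in>stages N s. \<Sum>r\<in>stages N s. ?g p r)" .
  moreover have "v \<in> carrier_vec (dim_row ?B)" unfolding dim v_def by simp
  ultimately show ?thesis
    using assms unfolding nonneg_definite_def by metis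
qed

lemma gark_P_entry:
  assumes "gark_coefficients N s A b" and "l < N" "m < N" and "i < s l" "j < s m"
  shows "gark_P A b l m $$ (i, j) =
    A m l $$ (j, i) * vec_index (b m) j + vec_index (b l) i * A l m $$ (i, j)
      - vec_index (b l) i * vec_index (b m) j"
proof -
  have A: "A l m \<in> carrier_mat (s l) (s m)" "A m l \<in> carrier_mat (s m) (s l)"
    and b: "dim_vec (b l) = s l" "dim_vec (b m) = s m"
    using assms by (auto simp: gark_coefficients_def)
  have At: "transpose_mat (A m l) \<in> carrier_mat (s l) (s m)" using A by simp
  have "(transpose_mat (A m l) * diag_of_vec (b m)) $$ (i, j)
      = A m l $$ (j, i) * vec_index (b m) j"
    using A b assms(4,5) by (simp add: diag_of_vec_def mat_diag_mult_right[OF At])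
  moreover have "(diag_of_vec (b l) * A l m) $$ (i, j) = vec_index (b l) i * A l m $$ (i, j)"
    using b assms(4,5) by (simp add: diag_of_vec_def mat_diag_mult_left[OF A(1)])
  moreover have "outer_product (b l) (b m) $$ (i, j) = vec_index (b l) i * vec_index (b m) j"
    using b assms(4,5)
    by (simp add: outer_product_def scalar_prod_def mat_of_cols_def mat_of_rows_def)
  moreover have "dim_row (diag_of_vec v) = dim_vec v" "dim_col (diag_of_vec v) = dim_vec v"
    "dim_row (outer_product v w) = dim_vec v" "dim_col (outer_product v w) = dim_vec w" for v w
    by (simp_all add: diag_of_vec_def mat_diag_def outer_product_def)
  ultimately show ?thesis
    using A b assms(4,5) by (simp add: gark_P_def del: index_mult_mat(1))
qed

section \<open>Nonlinear stability\<close>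

lemma gark_solution_difference:
  assumes "gark_solution N s A b f h y0 Y y1" and "gark_solution N s A b f h y0' Y' y1'"
  defines "F \<equiv> \<lambda>p. f (fst p) (Y' (fst p) (snd p)) - f (fst p) (Y (fst p) (snd p))"
  shows "\<And>p. p \<in> stages N s \<Longrightarrow> Y' (fst p) (snd p) - Y (fst p) (snd p)
      = (y0' - y0) + h *\<^sub>R (\<Sum>r\<in>stages N s. A (fst p) (fst r) $$ (snd p, snd r) *\<^sub>R F r)"
    and "y1' - y1 = (y0' - y0) + h *\<^sub>R (\<Sum>p\<in>stages N s. vec_index (b (fst p)) (snd p) *\<^sub>R F p)"
proof -
  have flat: "(\<Sum>m<N. \<Sum>j<s m. g m j) = (\<Sum>p\<in>stages N s. g (fst p) (snd p))"
    for g :: "nat \<Rightarrow> nat \<Rightarrow> 'a"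
    by (simp add: sum.Sigma case_prod_unfold)
  show "Y' (fst p) (snd p) - Y (fst p) (snd p)
      = (y0' - y0) + h *\<^sub>R (\<Sum>r\<in>stages N s. A (fst p) (fst r) $$ (snd p, snd r) *\<^sub>R F r)"
    if p: "p \<in> stages N s" for p
  proof -
    have "Y (fst p) (snd p) = y0 + h *\<^sub>R (\<Sum>r\<in>stages N s.
        A (fst p) (fst r) $$ (snd p, snd r) *\<^sub>R f (fst r) (Y (fst r) (snd r)))"
      and "Y' (fst p) (snd p) = y0' + h *\<^sub>R (\<Sum>r\<in>stages N s.
        A (fst p) (fst r) $$ (snd p, snd r) *\<^sub>R f (fst r) (Y' (fst r) (snd r)))"
      using assms(1,2) p unfolding gark_solution_def flat by auto
    then show ?thesis
      by (simp add: F_def scaleR_diff_right sum_subtractf algebra_simps)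
  qed
  have "y1 = y0 + h *\<^sub>R (\<Sum>p\<in>stages N s.
      vec_index (b (fst p)) (snd p) *\<^sub>R f (fst p) (Y (fst p) (snd p)))"
    and "y1' = y0' + h *\<^sub>R (\<Sum>p\<in>stages N s.
      vec_index (b (fst p)) (snd p) *\<^sub>R f (fst p) (Y' (fst p) (snd p)))"
    using assms(1,2) unfolding gark_solution_def flat by auto
  then show "y1' - y1
      = (y0' - y0) + h *\<^sub>R (\<Sum>p\<in>stages N s. vec_index (b (fst p)) (snd p) *\<^sub>R F p)"
    by (simp add: F_def scaleR_diff_right sum_subtractf algebra_simps)
qed

theorem theorem4p2:
  fixes N :: nat and s :: "nat \<Rightarrow> nat"
    and A :: "nat \<Rightarrow> nat \<Rightarrow> real mat" and b :: "nat \<Rightarrow> real vec"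
    and f :: "nat \<Rightarrow> real ^ 'd \<Rightarrow> real ^ 'd"
    and ip :: "real ^ 'd \<Rightarrow> real ^ 'd \<Rightarrow> real"
    and \<nu> :: "nat \<Rightarrow> real" and h :: real
    and y0 y1 y0' y1' :: "real ^ 'd"
    and Y Y' :: "nat \<Rightarrow> nat \<Rightarrow> real ^ 'd"
  assumes "is_scalar_product ip"
    and "\<And>m. m < N \<Longrightarrow> \<nu> m < 0"
    and "\<And>m y z. m < N \<Longrightarrow> ip (f m y - f m z) (y - z) \<le> \<nu> m * (ip_norm ip (y - z))\<^sup>2"
    and "gark_coefficients N s A b"
    and "algebraically_stable N s A b"
    and "h > 0"
    and "gark_solution N s A b f h y0 Y y1"
    and "gark_solution N s A b f h y0' Y' y1'"
  shows "ip_norm ip (y1' - y1) \<le> ip_norm ip (y0' - y0)"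
proof -
  define a where "a p r = A (fst p) (fst r) $$ (snd p, snd r)" for p r :: "nat \<times> nat"
  define \<beta> where "\<beta> p = vec_index (b (fst p)) (snd p)" for p :: "nat \<times> nat"
  define Z where "Z p = Y' (fst p) (snd p) - Y (fst p) (snd p)" for p
  define F where "F p = f (fst p) (Y' (fst p) (snd p)) - f (fst p) (Y (fst p) (snd p))" for p
  let ?K = "stages N s"
  let ?P = "\<lambda>p r. a r p * \<beta> r + \<beta> p * a p r - \<beta> p * \<beta> r"
  note diff = gark_solution_difference[OF assms(7,8)]
  have energy: "ip (y1' - y1) (y1' - y1) = ip (y0' - y0) (y0' - y0)
      + 2 * h * (\<Sum>p\<in>?K. \<beta> p * ip (F p) (Z p))
      - h\<^sup>2 * (\<Sum>p\<in>?K. \<Sum>r\<in>?K. ?P p r * ip (F p) (F r))"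
    by (rule energy_identity[OF assms(1)])
       (use diff in \<open>simp_all only: a_def \<beta>_def Z_def F_def\<close>)
  have dissipation: "(\<Sum>p\<in>?K. \<beta> p * ip (F p) (Z p)) \<le> 0"
  proof (rule sum_nonpos)
    fix p assume p: "p \<in> ?K"
    then have m: "fst p < N" by auto
    have "ip (F p) (Z p) \<le> \<nu> (fst p) * (ip_norm ip (Z p))\<^sup>2"
      unfolding F_def Z_def by (rule assms(3)[OF m])
    also have "\<dots> \<le> 0" using assms(2)[OF m] by (simp add: mult_nonpos_nonneg)
    finally have "ip (F p) (Z p) \<le> 0" .
    moreover have "0 \<le> \<beta> p"
      using assms(5) p by (auto simp: algebraically_stable_def \<beta>_def)
    ultimately show "\<beta> p * ip (F p) (Z p) \<le> 0" by (simp add: mult_nonneg_nonpos)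
  qed
  have "0 \<le> (\<Sum>p\<in>?K. \<Sum>r\<in>?K. ?P p r * ip (F p) (F r))"
  proof (rule vector_quadratic_form_nonneg[OF assms(1)])
    fix x :: "nat \<times> nat \<Rightarrow> real"
    have "0 \<le> (\<Sum>p\<in>?K. \<Sum>r\<in>?K.
        gark_P A b (fst p) (fst r) $$ (snd p, snd r) * (x p * x r))"
      using assms(5) unfolding algebraically_stable_def
      by (blast intro: nonneg_definite_block_matrixD)
    also have "\<dots> = (\<Sum>p\<in>?K. \<Sum>r\<in>?K. ?P p r * (x p * x r))"
      by (intro sum.cong refl)
         (auto simp: gark_P_entry[OF assms(4)] a_def \<beta>_def)
    finally show "0 \<le> (\<Sum>p\<in>?K. \<Sum>r\<in>?K. ?P p r * (x p * x r))" .
  qed simp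
  with dissipation assms(6) have "ip (y1' - y1) (y1' - y1) \<le> ip (y0' - y0) (y0' - y0)"
    unfolding energy by (smt (verit) mult_nonneg_nonpos mult_nonneg_nonneg zero_le_power2)
  then show ?thesis by (simp add: ip_norm_def)
qed

end
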